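(* Let $M$ be a model over a finite feature set $X$ and let $x\in X$ be a feature. Then the following are equivalent: (i) $x$ is useful for $M$; (ii) there is some entity $e$ over $X$ such that $x$ is necessary for $M(e)$; (iii) there is some entity $e$ over $X$ such that $x$ is relevant for $M(e)$.
   Context: $X$ is a finite set of features. Each feature $x\in X$ has a domain $\mathcal{D}_x$, which is a finite set if $x$ is categorical and an interval $[m_x,M_x]$ with $m_x\in\mathbb{R}\cup\{-\infty\}$, $M_x\in\mathbb{R}\cup\{\infty\}$ if $x$ is numerical. An entity over $X$ is a function $e$ with $e(x)\in\mathcal{D}_x$ for all $x\in X$. A ($k$-class) model over $X$ is a map $M$ from entities over $X$ to $\{0,\dots,k-1\}$. For $b\in\mathcal{D}_x$, $e_{x=b}$ is the entity with $e_{x=b}(x)=b$ and $e_{x=b}(y)=e(y)$ for $y\ne x$. A set $S\subseteq X$ is a reason for $M(e)$ if $M(e')=M(e)$ for every entity $e'$ with $e'(y)=e(y)$ for all $y\in S$. A sufficient reason for $M(e)$ is a reason that is minimal under inclusion. A feature $x$ is relevant for $M(e)$ if it belongs to some sufficient reason for $M(e)$, and necessary for $M(e)$ if it belongs to all sufficient reasons for $M(e)$. A feature $x$ is useful for $M$ if there are an entity $e$ over $X$ and $b\in\mathcal{D}_x$ such that $M(e)\neq M(e_{x=b})$. *)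

theory Defs
  imports "HOL-Library.FuncSet" "HOL-Library.Extended_Real"
begin

(* Categorical values are elements of an arbitrary type 'c, numerical values are reals; the
   tagged union lets features of both kinds occur in one feature set. *)
datatype 'c feature_value = Cat 'c | Num real

definition categorical_domain :: "'c feature_value set \<Rightarrow> bool" where
  "categorical_domain A \<longleftrightarrow> (\<exists>C. finite C \<and> A = Cat ` C)"

(* The interval [m, M] consists of real numbers only: an infinite endpoint means that the
   interval is unbounded on that side. *)
definition numerical_domain :: "'c feature_value set \<Rightarrow> bool" where
  "numerical_domain A \<longleftrightarrow>
     (\<exists>m M :: ereal. m \<noteq> \<infinity> \<and> M \<noteq> -\<infinity> \<and> A = Num ` {r :: real. m \<le> ereal r \<and> ereal r \<le> M})"

definition feature_domain :: "'c feature_value set \<Rightarrow> bool" where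
  "feature_domain A \<longleftrightarrow> categorical_domain A \<or> numerical_domain A"

type_synonym ('x, 'c) entity = "'x \<Rightarrow> 'c feature_value"

(* Entities are extensional functions, so that HOL equality of entities is equality on X, and
   for x in X and b in D x the entity e_{x=b} is the function update e(x := b). *)
definition entities :: "'x set \<Rightarrow> ('x \<Rightarrow> 'c feature_value set) \<Rightarrow> ('x, 'c) entity set" where
  "entities X D = (\<Pi>\<^sub>E x\<in>X. D x)"

(* Values of M outside the set of entities are unconstrained; no definition below uses them. *)
definition is_model ::
    "'x set \<Rightarrow> ('x \<Rightarrow> 'c feature_value set) \<Rightarrow> nat \<Rightarrow> (('x, 'c) entity \<Rightarrow> nat) \<Rightarrow> bool" where
  "is_model X D k M \<longleftrightarrow> M \<in> entities X D \<rightarrow> {..<k}"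

definition is_reason ::
    "'x set \<Rightarrow> ('x \<Rightarrow> 'c feature_value set) \<Rightarrow> (('x, 'c) entity \<Rightarrow> nat) \<Rightarrow> ('x, 'c) entity
     \<Rightarrow> 'x set \<Rightarrow> bool" where
  "is_reason X D M e S \<longleftrightarrow>
     S \<subseteq> X \<and> (\<forall>e'\<in>entities X D. (\<forall>y\<in>S. e' y = e y) \<longrightarrow> M e' = M e)"

definition sufficient_reason ::
    "'x set \<Rightarrow> ('x \<Rightarrow> 'c feature_value set) \<Rightarrow> (('x, 'c) entity \<Rightarrow> nat) \<Rightarrow> ('x, 'c) entity
     \<Rightarrow> 'x set \<Rightarrow> bool" where
  "sufficient_reason X D M e S \<longleftrightarrow>
     is_reason X D M e S \<and> (\<forall>T. T \<subset> S \<longrightarrow> \<not> is_reason X D M e T)"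

definition relevant ::
    "'x set \<Rightarrow> ('x \<Rightarrow> 'c feature_value set) \<Rightarrow> (('x, 'c) entity \<Rightarrow> nat) \<Rightarrow> ('x, 'c) entity
     \<Rightarrow> 'x \<Rightarrow> bool" where
  "relevant X D M e x \<longleftrightarrow> (\<exists>S. sufficient_reason X D M e S \<and> x \<in> S)"

definition necessary ::
    "'x set \<Rightarrow> ('x \<Rightarrow> 'c feature_value set) \<Rightarrow> (('x, 'c) entity \<Rightarrow> nat) \<Rightarrow> ('x, 'c) entity
     \<Rightarrow> 'x \<Rightarrow> bool" where
  "necessary X D M e x \<longleftrightarrow> (\<forall>S. sufficient_reason X D M e S \<longrightarrow> x \<in> S)"

definition useful ::
    "'x set \<Rightarrow> ('x \<Rightarrow> 'c feature_value set) \<Rightarrow> (('x, 'c) entity \<Rightarrow> nat) \<Rightarrow> 'x \<Rightarrow> bool" where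
  "useful X D M x \<longleftrightarrow> (\<exists>e\<in>entities X D. \<exists>b\<in>D x. M e \<noteq> M (e(x := b)))"

end

theory Submission
  imports Defs
begin

text \<open>
  If changing the value of \<open>x\<close> in \<open>e\<close> changes the class, then \<open>X - {x}\<close> is not a reason for
  \<open>M(e)\<close>, so every reason contains \<open>x\<close>. Conversely, if \<open>x\<close> lies in a sufficient reason \<open>S\<close> for
  \<open>M(e)\<close>, minimality gives an entity \<open>e'\<close> that agrees with \<open>e\<close> on \<open>S - {x}\<close> and has another class;
  resetting \<open>x\<close> in \<open>e'\<close> to \<open>e(x)\<close> restores the class \<open>M(e)\<close>, so \<open>x\<close> is useful.
\<close>

lemma entities_fun_upd:
  assumes "e \<in> entities X D" "x \<in> X" "b \<in> D x"
  shows "e(x := b) \<in> entities X D"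
  using assms unfolding entities_def by (auto simp: PiE_iff extensional_def)

text \<open>Entities are extensional, so agreement on all of \<open>X\<close> forces
  \<open>e' = e\<close>.\<close>

lemma is_reason_all_features:
  assumes "e \<in> entities X D"
  shows "is_reason X D M e X"
  using assms unfolding is_reason_def entities_def by (metis PiE_ext subset_refl)

text \<open>\<open>X\<close> is itself a reason, and a finite \<open>X\<close> has only finitely
  many subsets, so some reason is minimal.\<close>

lemma sufficient_reason_exists:
  assumes "finite X" "e \<in> entities X D"
  shows "\<exists>S. sufficient_reason X D M e S"
proof -
  let ?R = "{S. is_reason X D M e S}"
  have "?R \<subseteq> Pow X" by (auto simp: is_reason_def)
  then have "finite ?R" using assms(1) by (meson finite_Pow_iff finite_subset)
  moreover have "?R \<noteq> {}" using is_reason_all_features[OF assms(2)] by blast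
  ultimately obtain S where "S \<in> ?R" "\<forall>T\<in>?R. T \<subseteq> S \<longrightarrow> S = T"
    by (meson finite_has_minimal)
  then show ?thesis unfolding sufficient_reason_def by blast
qed

lemma useful_imp_necessary:
  assumes "x \<in> X" "useful X D M x"
  shows "\<exists>e\<in>entities X D. necessary X D M e x"
proof -
  obtain e b where e: "e \<in> entities X D" and b: "b \<in> D x" and ne: "M e \<noteq> M (e(x := b))"
    using assms(2) unfolding useful_def by blast
  \<comment> \<open>Otherwise \<open>e(x := b)\<close> would agree with \<open>e\<close> on
    \<open>S\<close>, against \<open>ne\<close>.\<close>
  have "x \<in> S" if "is_reason X D M e S" for S
    using that ne entities_fun_upd[OF e assms(1) b] unfolding is_reason_def
    by (metis fun_upd_other)
  then show ?thesis using e unfolding necessary_def sufficient_reason_def by blast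
qed

text \<open>Existence of a sufficient reason rules out vacuous necessity.\<close>

lemma necessary_imp_relevant:
  assumes "finite X" "e \<in> entities X D" "necessary X D M e x"
  shows "relevant X D M e x"
  using assms sufficient_reason_exists unfolding necessary_def relevant_def by blast

lemma relevant_imp_useful:
  assumes "e \<in> entities X D" "relevant X D M e x"
  shows "useful X D M x"
proof -
  obtain S where S: "is_reason X D M e S" "x \<in> S" and min: "\<not> is_reason X D M e (S - {x})"
    using assms(2) unfolding relevant_def sufficient_reason_def by blast
  have x: "x \<in> X" using S unfolding is_reason_def by blast
  then have ex: "e x \<in> D x" using assms(1) unfolding entities_def by blast
  obtain e' where e': "e' \<in> entities X D" "\<forall>y\<in>S - {x}. e' y = e y" "M e' \<noteq> M e"
    using S(1) min unfolding is_reason_def by blast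
  have "\<forall>y\<in>S. (e'(x := e x)) y = e y" using e'(2) by simp
  then have "M (e'(x := e x)) = M e"
    using S(1) entities_fun_upd[OF e'(1) x ex] unfolding is_reason_def by blast
  \<comment> \<open>The witnesses are the entity \<open>e'\<close> and the value
    \<open>e x\<close>.\<close>
  with e' ex show ?thesis unfolding useful_def by metis
qed

theorem theorem22:
  fixes X :: "'x set"
    and D :: "'x \<Rightarrow> 'c feature_value set"
    and k :: nat
    and M :: "('x, 'c) entity \<Rightarrow> nat"
    and x :: 'x
  assumes "finite X"
    and "\<And>y. y \<in> X \<Longrightarrow> feature_domain (D y)"
    and "is_model X D k M"
    and "x \<in> X"
  shows "(useful X D M x \<longleftrightarrow> (\<exists>e\<in>entities X D. necessary X D M e x)) \<and>
         ((\<exists>e\<in>entities X D. necessary X D M e x) \<longleftrightarrow> (\<exists>e\<in>entities X D. relevant X D M e x))"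
  using useful_imp_necessary[OF assms(4)] necessary_imp_relevant[OF assms(1)] relevant_imp_useful
  by metis

end
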